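(* Let $E$ and $F$ be two sandpile graphs. If $\mathrm{SP}(E)\cong\mathrm{SP}(F)$ as monoids, then $\mathcal{H}_E\cong\mathcal{H}_F$ as lattices.
   Context: Graphs are directed: $E=(E^0,E^1,s,r)$ with source and range maps $s,r:E^1\to E^0$. A sink is a vertex emitting no edges; a vertex is regular if it is not a sink and emits only finitely many edges; $E^0_{\mathrm{reg}}$ is the set of regular vertices. A sandpile graph is a finite directed graph with a unique sink (also denoted $s$) such that from every vertex there is a (possibly length-zero) path to $s$. Its sandpile monoid is the commutative monoid $$\mathrm{SP}(E)=\langle v\mid v\in E^0\rangle\big/\big\langle s=0;\ |s^{-1}(v)|\,v=\textstyle\sum_{e\in s^{-1}(v)}r(e)\ \text{for all } v\in E^0\setminus\{s\}\big\rangle,$$ the quotient of the free commutative monoid on $E^0$ by the congruence generated by these relations. $H\subseteq E^0$ is hereditary if $s(e)\in H$ implies $r(e)\in H$ for all $e\in E^1$; it is saturated if $v\in E^0_{\mathrm{reg}}$ and $r(s^{-1}(v))\subseteq H$ imply $v\in H$. $\overline{H}$ is the smallest hereditary saturated subset containing $H$. $\mathcal{H}_E$ is the set of all nonempty saturated hereditary subsets of $E^0$, a lattice under inclusion with $H\vee H'=\overline{H\cup H'}$ and $H\wedge H'=H\cap H'$. *)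

theory Defs
  imports
    "HOL.Hull"
    "HOL-Library.Multiset"
    "HOL-Algebra.Group"
    "HOL-Algebra.Lattice"
    "Graph_Theory.Digraph"
begin

section \<open>Commutative monoids given by generators and relations\<close>

text \<open>
  The free commutative monoid on \<open>X\<close> is the set of multisets supported on \<open>X\<close>.
\<close>

definition free_cm :: "'a set \<Rightarrow> 'a multiset set" where
  "free_cm X = {M. set_mset M \<subseteq> X}"

inductive_set gen_cong ::
    "'a set \<Rightarrow> ('a multiset \<times> 'a multiset) set \<Rightarrow> ('a multiset \<times> 'a multiset) set"
  for X :: "'a set" and R :: "('a multiset \<times> 'a multiset) set"
where
  base: "(M, N) \<in> R \<Longrightarrow> M \<in> free_cm X \<Longrightarrow> N \<in> free_cm X \<Longrightarrow> (M, N) \<in> gen_cong X R"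
| refl: "M \<in> free_cm X \<Longrightarrow> (M, M) \<in> gen_cong X R"
| sym: "(M, N) \<in> gen_cong X R \<Longrightarrow> (N, M) \<in> gen_cong X R"
| trans: "(M, N) \<in> gen_cong X R \<Longrightarrow> (N, K) \<in> gen_cong X R \<Longrightarrow> (M, K) \<in> gen_cong X R"
| add: "(M, N) \<in> gen_cong X R \<Longrightarrow> (M', N') \<in> gen_cong X R
    \<Longrightarrow> (M + M', N + N') \<in> gen_cong X R"

definition presented_cm ::
    "'a set \<Rightarrow> ('a multiset \<times> 'a multiset) set \<Rightarrow> 'a multiset set monoid" where
  "presented_cm X R =
    \<lparr>carrier = free_cm X // gen_cong X R,
     monoid.mult = (\<lambda>A B. \<Union>M\<in>A. \<Union>N\<in>B. gen_cong X R `` {M + N}),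
     one = gen_cong X R `` {{#}}\<rparr>"

lemma equiv_gen_cong: "equiv (free_cm X) (gen_cong X R)"
proof (rule equivI)
  show "refl_on (free_cm X) (gen_cong X R)"
    by (auto intro: refl_onI gen_cong.refl)
  show "Relation.sym (gen_cong X R)" by (auto intro: symI gen_cong.sym)
  show "Relation.trans (gen_cong X R)" by (auto intro: transI gen_cong.trans)
  show "gen_cong X R \<subseteq> free_cm X \<times> free_cm X"
  proof clarify
    fix M N assume "(M, N) \<in> gen_cong X R"
    then show "M \<in> free_cm X \<and> N \<in> free_cm X"
      by induction (auto simp: free_cm_def)
  qed
qed

lemma presented_cm_mult_class:
  assumes "M \<in> free_cm X" "N \<in> free_cm X"
  shows "(gen_cong X R `` {M}) \<otimes>\<^bsub>presented_cm X R\<^esub> (gen_cong X R `` {N})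
    = gen_cong X R `` {M + N}"
proof -
  have "(\<Union>M'\<in>gen_cong X R `` {M}. \<Union>N'\<in>gen_cong X R `` {N}. gen_cong X R `` {M' + N'})
      = gen_cong X R `` {M + N}"
    by (rule UN_equiv_class2[OF equiv_gen_cong equiv_gen_cong _ assms])
      (auto intro!: congruent2I' equiv_class_eq[OF equiv_gen_cong] gen_cong.add)
  then show ?thesis by (simp add: presented_cm_def)
qed

lemma comm_monoid_presented_cm: "comm_monoid (presented_cm X R)"
proof -
  have carr: "carrier (presented_cm X R) = (\<lambda>M. gen_cong X R `` {M}) ` free_cm X"
    by (auto simp: presented_cm_def quotient_def)
  have one: "\<one>\<^bsub>presented_cm X R\<^esub> = gen_cong X R `` {{#}}"
    by (simp add: presented_cm_def)
  have fm: "{#} \<in> free_cm X" "\<And>M N. M \<in> free_cm X \<Longrightarrow> N \<in> free_cm X \<Longrightarrow> M + N \<in> free_cm X"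
    by (auto simp: free_cm_def)
  show ?thesis
    by (rule comm_monoidI)
      (auto simp: carr one presented_cm_mult_class fm ac_simps)
qed

section \<open>Sandpile graphs and sandpile monoids\<close>

definition is_sink :: "('a, 'b) pre_digraph \<Rightarrow> 'a \<Rightarrow> bool" where
  "is_sink G v \<longleftrightarrow> v \<in> verts G \<and> out_arcs G v = {}"

definition regular_verts :: "('a, 'b) pre_digraph \<Rightarrow> 'a set" where
  "regular_verts G = {v \<in> verts G. \<not> is_sink G v \<and> finite (out_arcs G v)}"

text \<open>Loops and parallel arcs are allowed.\<close>

locale sandpile_graph = fin_digraph +
  assumes ex1_sink: "\<exists>!s. is_sink G s"
    and sink_reachable: "v \<in> verts G \<Longrightarrow> is_sink G s \<Longrightarrow> v \<rightarrow>\<^sup>*\<^bsub>G\<^esub> s"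

definition the_sink :: "('a, 'b) pre_digraph \<Rightarrow> 'a" where
  "the_sink G = (THE s. is_sink G s)"

text \<open>
  In the right-hand side of a toppling relation a vertex occurs once for each arc from \<open>v\<close> to it.
\<close>

definition sandpile_rels :: "('a, 'b) pre_digraph \<Rightarrow> ('a multiset \<times> 'a multiset) set" where
  "sandpile_rels G =
    insert ({#the_sink G#}, {#})
      {(replicate_mset (out_degree G v) v, image_mset (head G) (mset_set (out_arcs G v))) | v.
        v \<in> verts G - {the_sink G}}"

definition SP :: "('a, 'b) pre_digraph \<Rightarrow> 'a multiset set monoid" where
  "SP G = presented_cm (verts G) (sandpile_rels G)"

lemma comm_monoid_SP: "comm_monoid (SP G)"
  by (simp add: SP_def comm_monoid_presented_cm)

section \<open>The lattice of nonempty saturated hereditary sets\<close>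

definition hereditary :: "('a, 'b) pre_digraph \<Rightarrow> 'a set \<Rightarrow> bool" where
  "hereditary G H \<longleftrightarrow> H \<subseteq> verts G \<and> (\<forall>e\<in>arcs G. tail G e \<in> H \<longrightarrow> head G e \<in> H)"

definition saturated :: "('a, 'b) pre_digraph \<Rightarrow> 'a set \<Rightarrow> bool" where
  "saturated G H \<longleftrightarrow> H \<subseteq> verts G \<and>
    (\<forall>v\<in>regular_verts G. head G ` out_arcs G v \<subseteq> H \<longrightarrow> v \<in> H)"

definition her_sat_closure :: "('a, 'b) pre_digraph \<Rightarrow> 'a set \<Rightarrow> 'a set" where
  "her_sat_closure G H = (\<lambda>K. hereditary G K \<and> saturated G K) hull H"

definition her_sat_lattice :: "('a, 'b) pre_digraph \<Rightarrow> 'a set gorder" where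
  "her_sat_lattice G =
    \<lparr>carrier = {H. H \<noteq> {} \<and> hereditary G H \<and> saturated G H}, eq = (=), le = (\<subseteq>)\<rparr>"

definition lattice_iso :: "('a, 'c) gorder_scheme \<Rightarrow> ('b, 'd) gorder_scheme \<Rightarrow> ('a \<Rightarrow> 'b) \<Rightarrow> bool" where
  "lattice_iso L M h \<longleftrightarrow> bij_betw h (carrier L) (carrier M) \<and> join_pres L M h \<and> meet_pres L M h"

context sandpile_graph
begin

lemma is_sink_the_sink: "is_sink G (the_sink G)"
  unfolding the_sink_def using ex1_sink by (rule theI')

lemma hereditary_reachable:
  assumes "hereditary G H" "v \<in> H" "v \<rightarrow>\<^sup>*\<^bsub>G\<^esub> w"
  shows "w \<in> H"
  using assms(3,2) unfolding reachable_def
proof (induction rule: rtrancl_on_induct)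
  case (step y z)
  then show ?case using assms(1) by (auto simp: hereditary_def arcs_ends_conv)
qed

lemma the_sink_in_hereditary:
  assumes "hereditary G H" "H \<noteq> {}"
  shows "the_sink G \<in> H"
proof -
  obtain v where v: "v \<in> H" using assms(2) by auto
  then have "v \<in> verts G" using assms(1) by (auto simp: hereditary_def)
  then show ?thesis
    using hereditary_reachable[OF assms(1) v] sink_reachable is_sink_the_sink by blast
qed

lemma her_sat_closure_closed:
  assumes "H \<subseteq> verts G"
  shows "hereditary G (her_sat_closure G H)" "saturated G (her_sat_closure G H)"
    "H \<subseteq> her_sat_closure G H"
proof -
  have top: "hereditary G (verts G)" "saturated G (verts G)"
    by (auto simp: hereditary_def saturated_def regular_verts_def)
  have sub: "her_sat_closure G H \<subseteq> verts G"
    unfolding her_sat_closure_def using assms top by (intro hull_minimal) auto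
  show "hereditary G (her_sat_closure G H)"
    using sub by (auto simp: hereditary_def her_sat_closure_def hull_def)
  show "saturated G (her_sat_closure G H)"
    using sub unfolding saturated_def her_sat_closure_def hull_def by blast
  show "H \<subseteq> her_sat_closure G H"
    unfolding her_sat_closure_def by (rule hull_subset)
qed

lemma her_sat_closure_minimal:
  "H \<subseteq> K \<Longrightarrow> hereditary G K \<Longrightarrow> saturated G K \<Longrightarrow> her_sat_closure G H \<subseteq> K"
  unfolding her_sat_closure_def by (intro hull_minimal) auto

lemma her_sat_least:
  assumes "H \<in> carrier (her_sat_lattice G)" "K \<in> carrier (her_sat_lattice G)"
  shows "least (her_sat_lattice G) (her_sat_closure G (H \<union> K)) (Upper (her_sat_lattice G) {H, K})"
proof -
  have "H \<union> K \<subseteq> verts G"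
    using assms by (auto simp: her_sat_lattice_def hereditary_def)
  note c = her_sat_closure_closed[OF this]
  show ?thesis
    by (rule least_UpperI)
      (use assms c her_sat_closure_minimal[of "H \<union> K"] in
        \<open>auto simp: her_sat_lattice_def Upper_def\<close>)
qed

lemma her_sat_greatest:
  assumes "H \<in> carrier (her_sat_lattice G)" "K \<in> carrier (her_sat_lattice G)"
  shows "greatest (her_sat_lattice G) (H \<inter> K) (Lower (her_sat_lattice G) {H, K})"
proof -
  have "the_sink G \<in> H \<inter> K"
    using assms the_sink_in_hereditary by (auto simp: her_sat_lattice_def)
  moreover have "hereditary G (H \<inter> K)" "saturated G (H \<inter> K)"
    using assms by (auto simp: her_sat_lattice_def hereditary_def saturated_def)
  ultimately have "H \<inter> K \<in> carrier (her_sat_lattice G)"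
    by (auto simp: her_sat_lattice_def)
  then show ?thesis
    using assms by (intro greatest_LowerI) (auto simp: her_sat_lattice_def Lower_def)
qed

lemma lattice_her_sat_lattice: "lattice (her_sat_lattice G)"
proof -
  interpret partial_order "her_sat_lattice G"
    by unfold_locales (auto simp: her_sat_lattice_def)
  show ?thesis
  proof unfold_locales
    show "\<exists>S. least (her_sat_lattice G) S (Upper (her_sat_lattice G) {H, K})"
      if "H \<in> carrier (her_sat_lattice G)" "K \<in> carrier (her_sat_lattice G)" for H K
      using her_sat_least[OF that] by blast
    show "\<exists>S. greatest (her_sat_lattice G) S (Lower (her_sat_lattice G) {H, K})"
      if "H \<in> carrier (her_sat_lattice G)" "K \<in> carrier (her_sat_lattice G)" for H K
      using her_sat_greatest[OF that] by blast
  qed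
qed

lemma join_her_sat_lattice:
  assumes "H \<in> carrier (her_sat_lattice G)" "K \<in> carrier (her_sat_lattice G)"
  shows "H \<squnion>\<^bsub>her_sat_lattice G\<^esub> K = her_sat_closure G (H \<union> K)"
proof -
  interpret lattice "her_sat_lattice G" by (rule lattice_her_sat_lattice)
  show ?thesis
    unfolding join_def Lattice.sup_def
    by (rule some_equality) (rule her_sat_least[OF assms], rule least_unique[OF _ her_sat_least[OF assms]])
qed

lemma meet_her_sat_lattice:
  assumes "H \<in> carrier (her_sat_lattice G)" "K \<in> carrier (her_sat_lattice G)"
  shows "H \<sqinter>\<^bsub>her_sat_lattice G\<^esub> K = H \<inter> K"
proof -
  interpret lattice "her_sat_lattice G" by (rule lattice_her_sat_lattice)
  show ?thesis
    unfolding meet_def Lattice.inf_def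
    by (rule some_equality) (rule her_sat_greatest[OF assms], rule greatest_unique[OF _ her_sat_greatest[OF assms]])
qed

end

end

theory Submission
  imports Defs
begin

text \<open>
  An order ideal of a commutative monoid is a nonempty subset \<open>I\<close> with
  \<open>x + y \<in> I \<longleftrightarrow> x \<in> I \<and> y \<in> I\<close>; monoid isomorphisms preserve the inclusion order on order ideals.
  An order ideal is determined by the set \<open>H\<close> of generators it contains, and a set \<open>H\<close> of generators
  arises in this way iff for every defining relation \<open>M = N\<close> the support of \<open>M\<close> lies in \<open>H\<close> exactly
  when that of \<open>N\<close> does. For \<open>SP(G)\<close> the relation \<open>s = 0\<close> says that the sink lies in \<open>H\<close>, i.e. that
  \<open>H\<close> is nonempty, and the two directions of the condition for the toppling relations say that \<open>H\<close>
  is hereditary and saturated.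
\<close>

section \<open>Order ideals under monoid isomorphisms\<close>

definition order_ideals :: "('a, 'm) monoid_scheme \<Rightarrow> 'a set set" where
  "order_ideals P = {I. I \<subseteq> carrier P \<and> I \<noteq> {} \<and>
    (\<forall>x\<in>carrier P. \<forall>y\<in>carrier P. x \<otimes>\<^bsub>P\<^esub> y \<in> I \<longleftrightarrow> x \<in> I \<and> y \<in> I)}"

lemma inj_on_image_subset_iff:
  assumes "inj_on f C" "A \<subseteq> C" "B \<subseteq> C"
  shows "f ` A \<subseteq> f ` B \<longleftrightarrow> A \<subseteq> B"
proof
  assume sub: "f ` A \<subseteq> f ` B"
  show "A \<subseteq> B"
  proof
    fix x assume "x \<in> A"
    then have "f x \<in> f ` B" "x \<in> C" using sub assms(2) by blast+
    then show "x \<in> B" using inj_on_image_mem_iff[OF assms(1) _ assms(3)] by blast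
  qed
qed (rule image_mono)

lemma iso_image_order_ideal:
  assumes f: "f \<in> iso P Q" and P: "monoid P" and I: "I \<in> order_ideals P"
  shows "f ` I \<in> order_ideals Q"
proof -
  have bij: "bij_betw f (carrier P) (carrier Q)" using f by (simp add: iso_def)
  have sub: "I \<subseteq> carrier P" "I \<noteq> {}" using I by (auto simp: order_ideals_def)
  have mem: "f x \<in> f ` I \<longleftrightarrow> x \<in> I" if "x \<in> carrier P" for x
    using inj_on_image_mem_iff[OF bij_betw_imp_inj_on[OF bij] that sub(1)] .
  have mul: "f x \<otimes>\<^bsub>Q\<^esub> f y \<in> f ` I \<longleftrightarrow> f x \<in> f ` I \<and> f y \<in> f ` I"
    if "x \<in> carrier P" "y \<in> carrier P" for x y
  proof -
    have "f x \<otimes>\<^bsub>Q\<^esub> f y = f (x \<otimes>\<^bsub>P\<^esub> y)" using f that by (simp add: iso_def hom_def)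
    moreover have "x \<otimes>\<^bsub>P\<^esub> y \<in> I \<longleftrightarrow> x \<in> I \<and> y \<in> I"
      using I that by (simp add: order_ideals_def)
    ultimately show ?thesis
      using that P by (simp add: mem monoid.m_closed)
  qed
  have "carrier Q = f ` carrier P" using bij by (simp add: bij_betw_def)
  then show ?thesis
    using sub mul by (auto simp: order_ideals_def)
qed

lemma monoid_iso_inv_into:
  assumes "monoid P" and f: "f \<in> iso P Q"
  shows "inv_into (carrier P) f \<in> iso Q P"
proof -
  interpret monoid P by fact
  have bij: "bij_betw f (carrier P) (carrier Q)" using f by (simp add: iso_def)
  note inv = bij_betw_inv_into[OF bij] bij_betw_inv_into_right[OF bij]
  have "inv_into (carrier P) f (x \<otimes>\<^bsub>Q\<^esub> y) = inv_into (carrier P) f x \<otimes>\<^bsub>P\<^esub> inv_into (carrier P) f y"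
    if xy: "x \<in> carrier Q" "y \<in> carrier Q" for x y
    using f xy inv(2) bij_betw_apply[OF inv(1)]
    by (intro inv_into_f_eq[OF bij_betw_imp_inj_on[OF bij]]) (auto simp: iso_def hom_def)
  then show ?thesis
    using inv(1) bij_betw_apply[OF inv(1)] by (auto simp: iso_def hom_def)
qed

text \<open>The inverse isomorphism also maps order ideals to order ideals, and taking images under
  it undoes taking images under \<open>f\<close>.\<close>

lemma iso_bij_betw_order_ideals:
  assumes f: "f \<in> iso P Q" and P: "monoid P" and Q: "monoid Q"
  shows "bij_betw ((`) f) (order_ideals P) (order_ideals Q)"
proof -
  have bij: "bij_betw f (carrier P) (carrier Q)" using f by (simp add: iso_def)
  let ?g = "inv_into (carrier P) f"
  have g: "?g \<in> iso Q P" using P f by (rule monoid_iso_inv_into)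
  show ?thesis
  proof (rule bij_betw_byWitness[where f' = "(`) ?g"])
    show "\<forall>I\<in>order_ideals P. ?g ` f ` I = I"
      using bij by (auto simp: order_ideals_def bij_betw_def)
    show "\<forall>I\<in>order_ideals Q. f ` ?g ` I = I"
      using bij by (auto simp: order_ideals_def bij_betw_def image_inv_into_cancel)
  qed (use iso_image_order_ideal[OF f P] iso_image_order_ideal[OF g Q] in auto)
qed

section \<open>Order ideals of a presented commutative monoid\<close>

text \<open>The two \<open>free_cm X\<close> premises mirror the rule \<open>gen_cong.base\<close>,
  which admits only those pairs of \<open>R\<close> whose members are both supported in
  \<open>X\<close>.\<close>

definition compatible_sets :: "'a set \<Rightarrow> ('a multiset \<times> 'a multiset) set \<Rightarrow> 'a set set" where
  "compatible_sets X R = {H. H \<subseteq> X \<and>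
    (\<forall>(M, N)\<in>R. M \<in> free_cm X \<longrightarrow> N \<in> free_cm X \<longrightarrow> set_mset M \<subseteq> H \<longleftrightarrow> set_mset N \<subseteq> H)}"

text \<open>The map sending \<open>M\<close> to the truth value of
  \<open>set_mset M \<subseteq> H\<close> is a homomorphism from multisets to the booleans under
  conjunction. Its kernel is therefore a congruence, and it respects the generating pairs.\<close>

lemma compatible_gen_cong:
  assumes "(M, N) \<in> gen_cong X R" "H \<in> compatible_sets X R"
  shows "set_mset M \<subseteq> H \<longleftrightarrow> set_mset N \<subseteq> H"
  using assms by induction (auto simp: compatible_sets_def)

lemma carrier_presented_cm:
  "carrier (presented_cm X R) = (\<lambda>M. gen_cong X R `` {M}) ` free_cm X"
  by (auto simp: presented_cm_def quotient_def)

text \<open>The ideal condition splits off one generator at a time. The empty multiset is covered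
  because any \<open>x\<close> in the nonempty set \<open>I\<close> equals \<open>x\<close> times
  the unit, which puts the unit in \<open>I\<close>.\<close>

lemma gen_class_mem_order_ideal_iff:
  assumes I: "I \<in> order_ideals (presented_cm X R)" and "M \<in> free_cm X"
  shows "gen_cong X R `` {M} \<in> I \<longleftrightarrow> (\<forall>v\<in>#M. gen_cong X R `` {{#v#}} \<in> I)"
  using \<open>M \<in> free_cm X\<close>
proof (induction M)
  case empty
  obtain x where x: "x \<in> I" "x \<in> carrier (presented_cm X R)"
    using I by (auto simp: order_ideals_def)
  interpret comm_monoid "presented_cm X R" by (rule comm_monoid_presented_cm)
  have "\<one>\<^bsub>presented_cm X R\<^esub> \<in> I"
    using I x r_one[OF x(2)] one_closed unfolding order_ideals_def by fastforce
  then show ?case by (simp add: presented_cm_def)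
next
  case (add v M)
  then have fm: "{#v#} \<in> free_cm X" "M \<in> free_cm X" by (auto simp: free_cm_def)
  then have "gen_cong X R `` {{#v#} + M} \<in> I \<longleftrightarrow>
      gen_cong X R `` {{#v#}} \<in> I \<and> gen_cong X R `` {M} \<in> I"
    using I by (simp only: order_ideals_def carrier_presented_cm flip: presented_cm_mult_class) auto
  then show ?case using add.IH fm by simp
qed

definition generators_in :: "'a set \<Rightarrow> ('a multiset \<times> 'a multiset) set \<Rightarrow> 'a multiset set set \<Rightarrow> 'a set" where
  "generators_in X R I = {v \<in> X. gen_cong X R `` {{#v#}} \<in> I}"

lemma gen_class_mem_iff_generators_in:
  assumes "I \<in> order_ideals (presented_cm X R)" "M \<in> free_cm X"
  shows "gen_cong X R `` {M} \<in> I \<longleftrightarrow> set_mset M \<subseteq> generators_in X R I"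
  using gen_class_mem_order_ideal_iff[OF assms] assms(2)
  by (auto simp: generators_in_def free_cm_def)

text \<open>Every element of the monoid is the class of a multiset, and its membership in an ideal
  can be read off from the support. Besides the order statement this yields injectivity of
  \<open>generators_in\<close>.\<close>

lemma generators_in_subset_iff:
  assumes "I \<in> order_ideals (presented_cm X R)" "J \<in> order_ideals (presented_cm X R)"
  shows "generators_in X R I \<subseteq> generators_in X R J \<longleftrightarrow> I \<subseteq> J"
proof
  assume sub: "generators_in X R I \<subseteq> generators_in X R J"
  show "I \<subseteq> J"
  proof
    fix x assume "x \<in> I"
    moreover have "x \<in> carrier (presented_cm X R)"
      using \<open>x \<in> I\<close> assms(1) by (auto simp: order_ideals_def)
    ultimately show "x \<in> J"
      using sub gen_class_mem_iff_generators_in[OF assms(1)]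
        gen_class_mem_iff_generators_in[OF assms(2)]
      by (auto simp: carrier_presented_cm)
  qed
qed (auto simp: generators_in_def)

lemma generators_in_compatible:
  assumes "I \<in> order_ideals (presented_cm X R)"
  shows "generators_in X R I \<in> compatible_sets X R"
proof -
  have "set_mset M \<subseteq> generators_in X R I \<longleftrightarrow> set_mset N \<subseteq> generators_in X R I"
    if "(M, N) \<in> R" "M \<in> free_cm X" "N \<in> free_cm X" for M N
    using equiv_class_eq[OF equiv_gen_cong gen_cong.base[OF that]]
      gen_class_mem_iff_generators_in[OF assms] that by metis
  then show ?thesis by (auto simp: compatible_sets_def generators_in_def)
qed

text \<open>The ideal consists of the classes of all multisets supported in
  \<open>H\<close>.\<close>

lemma compatible_eq_generators_in:
  assumes H: "H \<in> compatible_sets X R"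
  shows "\<exists>I\<in>order_ideals (presented_cm X R). generators_in X R I = H"
proof -
  let ?c = "\<lambda>M. gen_cong X R `` {M}"
  let ?I = "?c ` free_cm H"
  have HX: "H \<subseteq> X" using H by (simp add: compatible_sets_def)
  \<comment> \<open>A class in \<open>?I\<close> is only known to have some representative supported
    in \<open>H\<close>; compatibility carries this over to every representative.\<close>
  have mem: "?c M \<in> ?I \<longleftrightarrow> set_mset M \<subseteq> H" if M: "M \<in> free_cm X" for M
  proof
    assume "?c M \<in> ?I"
    then obtain N where N: "set_mset N \<subseteq> H" "?c M = ?c N" by (auto simp: free_cm_def)
    then have "(M, N) \<in> gen_cong X R"
      using eq_equiv_class_iff[OF equiv_gen_cong M] HX by (auto simp: free_cm_def)
    then show "set_mset M \<subseteq> H" using compatible_gen_cong[OF _ H] N by blast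
  qed (auto simp: free_cm_def)
  have add: "M + N \<in> free_cm X" if "M \<in> free_cm X" "N \<in> free_cm X" for M N
    using that by (auto simp: free_cm_def)
  have "free_cm H \<subseteq> free_cm X" "{#} \<in> free_cm H" using HX by (auto simp: free_cm_def)
  then have "?I \<in> order_ideals (presented_cm X R)"
    unfolding order_ideals_def carrier_presented_cm
    by (auto simp: presented_cm_mult_class mem add simp del: image_iff)
  moreover have "generators_in X R ?I = H"
    using HX mem[of "{#_#}"] by (auto simp: generators_in_def free_cm_def)
  ultimately show ?thesis by blast
qed

lemma bij_betw_generators_in:
  "bij_betw (generators_in X R) (order_ideals (presented_cm X R)) (compatible_sets X R)"
  unfolding bij_betw_def
proof
  show "inj_on (generators_in X R) (order_ideals (presented_cm X R))"
    by (rule inj_onI) (metis generators_in_subset_iff subset_antisym subset_refl)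
  show "generators_in X R ` order_ideals (presented_cm X R) = compatible_sets X R"
    using generators_in_compatible[of _ X R] compatible_eq_generators_in[of _ X R] by blast
qed

section \<open>Compatible sets of the sandpile relations\<close>

lemma (in sandpile_graph) compatible_sandpile_rels:
  "compatible_sets (verts G) (sandpile_rels G) = carrier (her_sat_lattice G)"
proof (rule Set.set_eqI)
  fix H
  have sink: "the_sink G \<in> verts G" "out_arcs G (the_sink G) = {}"
    using is_sink_the_sink by (auto simp: is_sink_def)
  have sink_unique: "out_arcs G v \<noteq> {}" if "v \<in> verts G" "v \<noteq> the_sink G" for v
    using that ex1_sink is_sink_the_sink by (auto simp: is_sink_def)
  have reg: "regular_verts G = verts G - {the_sink G}"
    using sink sink_unique by (auto simp: regular_verts_def is_sink_def)
  define l where "l v = replicate_mset (out_degree G v) v" for v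
  define r where "r v = image_mset (head G) (mset_set (out_arcs G v))" for v
  \<comment> \<open>A non-sink has positive out-degree, so the left side of its toppling relation
    really contains \<open>v\<close>.\<close>
  have l: "set_mset (l v) = {v}" if "v \<in> verts G" "v \<noteq> the_sink G" for v
    using sink_unique[OF that] by (simp add: l_def out_degree_def finite_out_arcs)
  have r: "set_mset (r v) = head G ` out_arcs G v" for v
    by (simp add: r_def finite_out_arcs)
  have heads: "head G ` out_arcs G v \<subseteq> verts G" for v
    by auto
  have rels: "sandpile_rels G =
      insert ({#the_sink G#}, {#}) ((\<lambda>v. (l v, r v)) ` (verts G - {the_sink G}))"
    by (auto simp: sandpile_rels_def l_def r_def)
  have free: "l v \<in> free_cm (verts G)" "r v \<in> free_cm (verts G)" if "v \<in> verts G" "v \<noteq> the_sink G" for v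
    using l[OF that] r[of v] heads[of v] that(1) by (simp_all only: free_cm_def mem_Collect_eq) simp
  have topple: "(l v \<in> free_cm (verts G) \<longrightarrow> r v \<in> free_cm (verts G) \<longrightarrow>
        set_mset (l v) \<subseteq> H \<longleftrightarrow> set_mset (r v) \<subseteq> H) \<longleftrightarrow>
      (v \<in> H \<longleftrightarrow> head G ` out_arcs G v \<subseteq> H)" if "v \<in> verts G - {the_sink G}" for v
  proof -
    have v: "v \<in> verts G" "v \<noteq> the_sink G" using that by auto
    show ?thesis unfolding l[OF v] r using free[OF v] by simp
  qed
  \<comment> \<open>The empty multiset is supported in every \<open>H\<close>, so the relation
    \<open>s = 0\<close> forces the sink into \<open>H\<close>.\<close>
  have "H \<in> compatible_sets (verts G) (sandpile_rels G) \<longleftrightarrow> H \<subseteq> verts G \<and> the_sink G \<in> H \<and>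
      (\<forall>v\<in>verts G - {the_sink G}. l v \<in> free_cm (verts G) \<longrightarrow> r v \<in> free_cm (verts G) \<longrightarrow>
        set_mset (l v) \<subseteq> H \<longleftrightarrow> set_mset (r v) \<subseteq> H)"
    unfolding compatible_sets_def rels using sink(1)
    by (simp only: mem_Collect_eq ball_simps case_prod_conv) (simp add: free_cm_def)
  then have *: "H \<in> compatible_sets (verts G) (sandpile_rels G) \<longleftrightarrow> H \<subseteq> verts G \<and> the_sink G \<in> H \<and>
      (\<forall>v\<in>verts G - {the_sink G}. v \<in> H \<longleftrightarrow> head G ` out_arcs G v \<subseteq> H)"
    using topple by (simp only: Ball_def cong: imp_cong)
  \<comment> \<open>The sink emits no arcs, so the hereditary condition holds at it
    vacuously.\<close>
  have her: "hereditary G H \<longleftrightarrow> H \<subseteq> verts G \<and>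
      (\<forall>v\<in>verts G - {the_sink G}. v \<in> H \<longrightarrow> head G ` out_arcs G v \<subseteq> H)"
  proof
    assume H: "H \<subseteq> verts G \<and>
      (\<forall>v\<in>verts G - {the_sink G}. v \<in> H \<longrightarrow> head G ` out_arcs G v \<subseteq> H)"
    have "head G e \<in> H" if e: "e \<in> arcs G" "tail G e \<in> H" for e
    proof -
      have out: "e \<in> out_arcs G (tail G e)" using e(1) by simp
      then have "tail G e \<noteq> the_sink G" using sink(2) by (metis empty_iff)
      then have "head G ` out_arcs G (tail G e) \<subseteq> H" using H e by blast
      then show ?thesis using out by blast
    qed
    then show "hereditary G H" using H by (simp add: hereditary_def)
  qed (auto simp: hereditary_def)
  have sat: "saturated G H \<longleftrightarrow> H \<subseteq> verts G \<and>
      (\<forall>v\<in>verts G - {the_sink G}. head G ` out_arcs G v \<subseteq> H \<longrightarrow> v \<in> H)"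
    by (simp only: saturated_def reg)
  \<comment> \<open>Every vertex reaches the sink, so a hereditary set is nonempty exactly when it
    contains the sink.\<close>
  have "H \<in> carrier (her_sat_lattice G) \<longleftrightarrow> the_sink G \<in> H \<and> hereditary G H \<and> saturated G H"
    using the_sink_in_hereditary by (auto simp: her_sat_lattice_def)
  also have "\<dots> \<longleftrightarrow> H \<in> compatible_sets (verts G) (sandpile_rels G)"
    unfolding * her sat unfolding Ball_def by iprover
  finally show "H \<in> compatible_sets (verts G) (sandpile_rels G) \<longleftrightarrow> H \<in> carrier (her_sat_lattice G)"
    by (rule HOL.sym)
qed

section \<open>From order isomorphisms to lattice isomorphisms\<close>

lemma order_iso_imp_lattice_iso:
  assumes L: "lattice L" and M: "lattice M"
    and bij: "bij_betw h (carrier L) (carrier M)"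
    and le: "\<And>x y. x \<in> carrier L \<Longrightarrow> y \<in> carrier L \<Longrightarrow> h x \<sqsubseteq>\<^bsub>M\<^esub> h y \<longleftrightarrow> x \<sqsubseteq>\<^bsub>L\<^esub> y"
  shows "lattice_iso L M h"
proof -
  interpret L: lattice L by (rule L)
  interpret M: lattice M by (rule M)
  have h: "h x \<in> carrier M" if "x \<in> carrier L" for x
    using bij that by (rule bij_betw_apply)
  have surj: "\<exists>x\<in>carrier L. z = h x" if "z \<in> carrier M" for z
    using bij that by (auto simp: bij_betw_def)
  have "h (x \<squnion>\<^bsub>L\<^esub> y) = h x \<squnion>\<^bsub>M\<^esub> h y" if xy: "x \<in> carrier L" "y \<in> carrier L" for x y
  proof -
    \<comment> \<open>Pulling the join in \<open>M\<close> back to \<open>z\<close> lets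
      \<open>le\<close> reflect its upper bound property to \<open>L\<close>, where \<open>z\<close>
      dominates the join of \<open>x\<close> and \<open>y\<close>.\<close>
    obtain z where z: "z \<in> carrier L" "h x \<squnion>\<^bsub>M\<^esub> h y = h z"
      using surj[OF M.join_closed] h xy by blast
    have "x \<sqsubseteq>\<^bsub>L\<^esub> z" "y \<sqsubseteq>\<^bsub>L\<^esub> z"
      using M.join_left[of "h x" "h y"] M.join_right[of "h x" "h y"] h xy z le by auto
    then have "h (x \<squnion>\<^bsub>L\<^esub> y) \<sqsubseteq>\<^bsub>M\<^esub> h z"
      using xy z le L.join_le by simp
    moreover have "h x \<squnion>\<^bsub>M\<^esub> h y \<sqsubseteq>\<^bsub>M\<^esub> h (x \<squnion>\<^bsub>L\<^esub> y)"
      using xy h le L.join_left L.join_right by (intro M.join_le) auto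
    ultimately show ?thesis using z h xy by (auto intro!: M.le_antisym)
  qed
  moreover have "h (x \<sqinter>\<^bsub>L\<^esub> y) = h x \<sqinter>\<^bsub>M\<^esub> h y" if xy: "x \<in> carrier L" "y \<in> carrier L" for x y
  proof -
    obtain z where z: "z \<in> carrier L" "h x \<sqinter>\<^bsub>M\<^esub> h y = h z"
      using surj[OF M.meet_closed] h xy by blast
    have "z \<sqsubseteq>\<^bsub>L\<^esub> x" "z \<sqsubseteq>\<^bsub>L\<^esub> y"
      using M.meet_left[of "h x" "h y"] M.meet_right[of "h x" "h y"] h xy z le by auto
    then have "h z \<sqsubseteq>\<^bsub>M\<^esub> h (x \<sqinter>\<^bsub>L\<^esub> y)"
      using xy z le L.meet_le by simp
    moreover have "h (x \<sqinter>\<^bsub>L\<^esub> y) \<sqsubseteq>\<^bsub>M\<^esub> h x \<sqinter>\<^bsub>M\<^esub> h y"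
      using xy h le L.meet_left L.meet_right by (intro M.meet_le) auto
    ultimately show ?thesis using z h xy by (auto intro!: M.le_antisym)
  qed
  ultimately show ?thesis
    using L M bij by (simp add: lattice_iso_def join_pres_def meet_pres_def)
qed

theorem corollary2p11:
  fixes E :: "('a, 'b) pre_digraph" and F :: "('c, 'd) pre_digraph"
  assumes "sandpile_graph E" and "sandpile_graph F"
    and "SP E \<cong> SP F"
  shows "\<exists>h. lattice_iso (her_sat_lattice E) (her_sat_lattice F) h"
proof -
  obtain f where f: "f \<in> iso (SP E) (SP F)" using assms(3) by (auto simp: is_iso_def)
  have mon: "monoid (SP E)" "monoid (SP F)"
    by (rule comm_monoid.axioms(1)[OF comm_monoid_SP])+
  let ?e = "generators_in (verts E) (sandpile_rels E)"
  let ?f = "generators_in (verts F) (sandpile_rels F)"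
  have e: "bij_betw ?e (order_ideals (SP E)) (carrier (her_sat_lattice E))"
    and g: "bij_betw ?f (order_ideals (SP F)) (carrier (her_sat_lattice F))"
    unfolding SP_def assms(1,2)[THEN sandpile_graph.compatible_sandpile_rels, symmetric]
    by (rule bij_betw_generators_in)+
  note im = iso_bij_betw_order_ideals[OF f mon]
  let ?d = "inv_into (order_ideals (SP E)) ?e"
  \<comment> \<open>A vertex set of \<open>E\<close> is turned into its order ideal, moved along
    \<open>f\<close>, and read back as a vertex set of \<open>F\<close>. Each of the three maps
    preserves and reflects inclusion.\<close>
  let ?h = "?f \<circ> ((`) f \<circ> ?d)"
  have d: "bij_betw ?d (carrier (her_sat_lattice E)) (order_ideals (SP E))"
    using e by (rule bij_betw_inv_into)
  have bij: "bij_betw ?h (carrier (her_sat_lattice E)) (carrier (her_sat_lattice F))"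
    by (intro bij_betw_trans[OF _ g] bij_betw_trans[OF d im])
  have "?h H \<subseteq> ?h K \<longleftrightarrow> H \<subseteq> K"
    if HK: "H \<in> carrier (her_sat_lattice E)" "K \<in> carrier (her_sat_lattice E)" for H K
  proof -
    have oi: "?d H \<in> order_ideals (SP E)" "?d K \<in> order_ideals (SP E)"
      using HK d by (auto dest: bij_betw_apply)
    then have "f ` ?d H \<in> order_ideals (SP F)" "f ` ?d K \<in> order_ideals (SP F)"
      using bij_betw_apply[OF im] by blast+
    then have "?h H \<subseteq> ?h K \<longleftrightarrow> f ` ?d H \<subseteq> f ` ?d K"
      using generators_in_subset_iff[of _ "verts F" "sandpile_rels F"] by (simp flip: SP_def)
    also have "\<dots> \<longleftrightarrow> ?d H \<subseteq> ?d K"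
      using f oi by (intro inj_on_image_subset_iff) (auto simp: iso_def bij_betw_def order_ideals_def)
    also have "\<dots> \<longleftrightarrow> ?e (?d H) \<subseteq> ?e (?d K)"
      using oi generators_in_subset_iff[of _ "verts E" "sandpile_rels E"] by (simp flip: SP_def)
    finally show ?thesis
      using HK by (simp add: bij_betw_inv_into_right[OF e])
  qed
  then have "lattice_iso (her_sat_lattice E) (her_sat_lattice F) ?h"
    using assms(1,2)[THEN sandpile_graph.lattice_her_sat_lattice] bij
    by (intro order_iso_imp_lattice_iso) (auto simp: her_sat_lattice_def)
  then show ?thesis by blast
qed

end
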